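(* Let $G$ and $H$ be connected graphs with $\mathrm{vol}(G)\ge 6$, and let $f:V(G)\to V(H)$ be any non-constant function. Then $$\sum_{u,v} d_H(f(u),f(v))^2 d_u d_v\ \ge\ \mathrm{vol}(G)-1,$$ where the sum is over unordered pairs $\{u,v\}$ of vertices of $G$.
   Context: Graphs are finite and simple; $d_u$ is the degree of $u$ in $G$, $\mathrm{vol}(G)=\sum_{u\in V(G)}d_u$, and $d_H$ is the shortest-path distance in $H$. *)

theory Defs
  imports "Graph_Theory.Graph_Theory"
begin

text \<open>
  A finite simple graph is a \<open>graph\<close> of the library: a finite symmetric digraph without loops and
  without parallel arcs, in which an edge uv is the pair of arcs from u to v and from v to u. So
  \<open>out_degree\<close> counts the neighbours of a vertex. The library's \<open>connected\<close> requires at least one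
  vertex.
\<close>

definition vol :: "('a, 'b) pre_digraph \<Rightarrow> nat" where
  "vol G = (\<Sum>u\<in>verts G. out_degree G u)"

text \<open>
  The library's shortest-path cost is an extended real, infinite when no walk exists; between
  vertices of a connected graph the conversion to a real loses nothing.
\<close>

definition gdist :: "('a, 'b) pre_digraph \<Rightarrow> 'a \<Rightarrow> 'a \<Rightarrow> real" where
  "gdist G u v = real_of_ereal (wf_digraph.\<mu> G (\<lambda>_. 1) u v)"

text \<open>
  The sum of g u v over the unordered pairs of distinct elements of V, each pair being counted once.
  It is meaningful only for g symmetric on V, when the description below denotes the common value
  of g u v and g v u.
\<close>

definition sum_pairs :: "('a \<Rightarrow> 'a \<Rightarrow> real) \<Rightarrow> 'a set \<Rightarrow> real" where
  "sum_pairs g V = (\<Sum>e\<in>{e. e \<subseteq> V \<and> card e = 2}. THE x. \<exists>u v. e = {u, v} \<and> x = g u v)"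

lemma the_pair_value:
  assumes "g u v = g v u"
  shows "(THE x. \<exists>a b. {u, v} = {a, b} \<and> x = g a b) = (g u v :: real)"
  using assms by (intro the_equality) (auto simp: doubleton_eq_iff)

lemma sum_pairs_ordered:
  assumes fin: "finite V" and sym: "\<And>u v. u \<in> V \<Longrightarrow> v \<in> V \<Longrightarrow> g u v = g v u"
    and diag: "\<And>u. u \<in> V \<Longrightarrow> g u u = 0"
  shows "2 * sum_pairs g V = (\<Sum>u\<in>V. \<Sum>v\<in>V. g u v)"
proof -
  let ?P = "{e. e \<subseteq> V \<and> card e = 2}"
  let ?S = "{p \<in> V \<times> V. fst p \<noteq> snd p}"
  let ?h = "\<lambda>p. {fst p, snd p}"
  have finP: "finite ?P" using fin by simp
  have finS: "finite ?S" using fin by simp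
  have im: "?h ` ?S \<subseteq> ?P" by auto
  have fibre: "(\<Sum>p\<in>{p \<in> ?S. ?h p = e}. g (fst p) (snd p))
      = 2 * (THE x. \<exists>u v. e = {u, v} \<and> x = g u v)" if "e \<in> ?P" for e
  proof -
    from that obtain a b where e: "e = {a, b}" "a \<noteq> b" "a \<in> V" "b \<in> V"
      by (auto simp: card_2_iff)
    have "{p \<in> ?S. ?h p = e} = {(a, b), (b, a)}"
      using e by (auto simp: doubleton_eq_iff)
    then show ?thesis
      using e sym[of a b] by (simp add: the_pair_value)
  qed
  have "(\<Sum>u\<in>V. \<Sum>v\<in>V. g u v) = (\<Sum>p\<in>V \<times> V. g (fst p) (snd p))"
    by (simp add: sum.cartesian_product case_prod_beta)
  also have "\<dots> = (\<Sum>p\<in>?S. g (fst p) (snd p))"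
    using fin diag by (intro sum.mono_neutral_right) auto
  also have "\<dots> = (\<Sum>e\<in>?P. \<Sum>p\<in>{p \<in> ?S. ?h p = e}. g (fst p) (snd p))"
    using sum.group[OF finS finP im, of "\<lambda>p. g (fst p) (snd p)"] by simp
  also have "\<dots> = 2 * sum_pairs g V"
    using fibre by (simp add: sum_pairs_def sum_distrib_left)
  finally show ?thesis by simp
qed

lemma (in wf_digraph) gdist_eq_least_length:
  assumes "u \<rightarrow>\<^sup>* v"
  shows "gdist G u v = real (LEAST n. \<exists>p. awalk u p v \<and> length p = n)"
proof -
  let ?Q = "\<lambda>n. \<exists>p. awalk u p v \<and> length p = n"
  have cost: "awalk_cost (\<lambda>_. 1) p = real (length p)" for p :: "'b awalk"
    by (induct p) auto
  obtain p0 where "awalk u p0 v" using assms by (auto simp: reachable_awalk)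
  then have "?Q (Least ?Q)" by (intro LeastI[of ?Q "length p0"]) blast
  then obtain p where p: "awalk u p v" "length p = Least ?Q" by blast
  have "\<mu> (\<lambda>_. 1) u v = ereal (real (Least ?Q))"
    unfolding \<mu>_def
  proof (rule INF_eqI)
    fix q assume "q \<in> {p. awalk u p v}"
    then have "Least ?Q \<le> length q" by (intro Least_le) blast
    then show "ereal (real (Least ?Q)) \<le> ereal (awalk_cost (\<lambda>_. 1) q)" by (simp add: cost)
  next
    fix y assume "\<And>q. q \<in> {p. awalk u p v} \<Longrightarrow> y \<le> ereal (awalk_cost (\<lambda>_. 1) q)"
    from this[of p] p show "y \<le> ereal (real (Least ?Q))" by (simp add: cost)
  qed
  then show ?thesis by (simp add: gdist_def)
qed

lemma (in sym_digraph) awalk_reverse: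
  "awalk u p v \<Longrightarrow> \<exists>q. awalk v q u \<and> length q = length p"
proof (induct p arbitrary: u)
  case Nil then show ?case by (intro exI[of _ "[]"]) (auto simp: awalk_Nil_iff)
next
  case (Cons e p)
  then have e: "e \<in> arcs G" "tail G e = u" and w: "awalk (head G e) p v"
    by (auto simp: awalk_Cons_iff)
  from Cons.hyps[OF w] obtain q where q: "awalk v q (head G e)" "length q = length p" by blast
  from sym_arcs e(1) obtain e' where e': "e' \<in> arcs G" "tail G e' = head G e" "head G e' = tail G e"
    unfolding symmetric_conv by metis
  have "awalk (head G e) [e'] u" using e e' by (auto simp: awalk_Cons_iff awalk_Nil_iff)
  then have "awalk v (q @ [e']) u" using q by (auto intro: awalk_appendI)
  then show ?case using q by (intro exI[of _ "q @ [e']"]) simp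
qed

lemma (in sym_digraph) gdist_sym: "gdist G u v = gdist G v u"
proof -
  have reach: "(u \<rightarrow>\<^sup>* v) = (v \<rightarrow>\<^sup>* u)"
    using awalk_reverse by (meson reachable_awalk)
  have Q: "(\<exists>p. awalk u p v \<and> length p = n) = (\<exists>p. awalk v p u \<and> length p = n)" for n
    using awalk_reverse by metis
  show ?thesis
  proof (cases "u \<rightarrow>\<^sup>* v")
    case True then show ?thesis using reach Q by (simp add: gdist_eq_least_length)
  next
    case False then show ?thesis using reach by (simp add: gdist_def shortest_path_inf)
  qed
qed

end

(*
  Fix a vertex a and let S be its fibre under f. Every pair that crosses the cut between S and its
  complement has distance at least 1, so the sum is at least s * (vol G - s), where s is the sum of
  the degrees in S. As f is not constant and all degrees are positive, 1 <= s <= vol G - 1, hence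
  s * (vol G - s) >= vol G - 1.
*)
theory Submission
  imports Defs
begin

lemma (in wf_digraph) gdist_refl:
  assumes "u \<in> verts G"
  shows "gdist G u u = 0"
proof -
  have "(LEAST n. \<exists>p. awalk u p u \<and> length p = n) = 0"
    using assms by (intro Least_eq_0) (auto simp: awalk_Nil_iff)
  then show ?thesis
    using assms by (simp add: gdist_eq_least_length)
qed

text \<open>Only the empty walk has length 0, and its two ends coincide. Reachability matters here:
  without a walk the infinite cost is converted to the real 0.\<close>

lemma (in wf_digraph) gdist_ge_1:
  assumes "u \<rightarrow>\<^sup>* v" and "u \<noteq> v"
  shows "1 \<le> gdist G u v"
proof -
  let ?Q = "\<lambda>n. \<exists>p. awalk u p v \<and> length p = n"
  obtain p0 where "awalk u p0 v"
    using assms(1) by (auto simp: reachable_awalk)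
  then have "?Q (Least ?Q)"
    by (intro LeastI[of ?Q "length p0"]) blast
  then have "Least ?Q \<noteq> 0"
    using assms(2) by (metis awalk_Nil_iff length_0_conv)
  then show ?thesis
    using assms(1) by (simp add: gdist_eq_least_length)
qed

text \<open>The library's \<open>connected\<close> refers to the symmetric closure of the digraph;
  when the arcs are already symmetric, this gives directed walks in the digraph itself.\<close>

lemma (in sym_digraph) connected_imp_reachable:
  assumes "connected G" and "u \<in> verts G" and "v \<in> verts G"
  shows "u \<rightarrow>\<^sup>* v"
  using symmetric_connected_imp_strongly_connected[OF sym_arcs assms(1)] assms(2,3)
  by auto

text \<open>A walk between distinct vertices is nonempty, and its first arc leaves
  \<open>u\<close>.\<close>

lemma (in fin_digraph) out_degree_pos:
  assumes "u \<rightarrow>\<^sup>* v" and "u \<noteq> v"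
  shows "0 < out_degree G u"
proof -
  from assms obtain w where "u \<rightarrow>\<^bsub>G\<^esub> w"
    by (meson converse_reachable_cases)
  then have "out_arcs G u \<noteq> {}"
    by (auto simp: arcs_ends_def arc_to_ends_def out_arcs_def)
  then show ?thesis
    by (simp add: out_degree_def card_gt_0_iff finite_out_arcs)
qed

text \<open>Cutting \<open>V\<close> into \<open>S\<close> and \<open>V - S\<close> splits the
  double sum over ordered pairs into four blocks. Symmetry makes the two crossing blocks equal,
  which absorbs the factor 2 of \<open>sum_pairs_ordered\<close>; the two inner blocks are
  nonnegative and are dropped.\<close>

lemma cut_sum_le_sum_pairs:
  assumes fin: "finite V" and "S \<subseteq> V"
    and sym: "\<And>u v. u \<in> V \<Longrightarrow> v \<in> V \<Longrightarrow> g u v = g v u"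
    and diag: "\<And>u. u \<in> V \<Longrightarrow> g u u = 0"
    and nonneg: "\<And>u v. u \<in> V \<Longrightarrow> v \<in> V \<Longrightarrow> 0 \<le> g u v"
  shows "(\<Sum>u\<in>S. \<Sum>v\<in>V - S. g u v) \<le> sum_pairs g V"
proof -
  let ?T = "V - S"
  have split: "sum h V = sum h S + sum h ?T" for h :: "'a \<Rightarrow> real"
    using sum.subset_diff[OF \<open>S \<subseteq> V\<close> fin, of h] by simp
  have "(\<Sum>u\<in>?T. \<Sum>v\<in>S. g u v) = (\<Sum>u\<in>S. \<Sum>v\<in>?T. g v u)"
    by (rule sum.swap)
  also have "\<dots> = (\<Sum>u\<in>S. \<Sum>v\<in>?T. g u v)"
    using \<open>S \<subseteq> V\<close> by (intro sum.cong refl sym) auto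
  finally have "(\<Sum>u\<in>V. \<Sum>v\<in>V. g u v) = 2 * (\<Sum>u\<in>S. \<Sum>v\<in>?T. g u v)
      + (\<Sum>u\<in>S. \<Sum>v\<in>S. g u v) + (\<Sum>u\<in>?T. \<Sum>v\<in>?T. g u v)"
    by (simp add: split sum.distrib)
  moreover have "0 \<le> (\<Sum>u\<in>S. \<Sum>v\<in>S. g u v)" "0 \<le> (\<Sum>u\<in>?T. \<Sum>v\<in>?T. g u v)"
    using \<open>S \<subseteq> V\<close> by (auto intro!: sum_nonneg nonneg)
  moreover have "2 * sum_pairs g V = (\<Sum>u\<in>V. \<Sum>v\<in>V. g u v)"
    by (rule sum_pairs_ordered[OF fin sym diag])
  ultimately show ?thesis by linarith
qed

theorem theorem3p2:
  fixes G :: "('a, 'b) pre_digraph" and H :: "('c, 'd) pre_digraph" and f :: "'a \<Rightarrow> 'c"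
  assumes "graph G" and "Digraph_Component.connected G"
    and "graph H" and "Digraph_Component.connected H"
    and "vol G \<ge> 6"
    and "f ` verts G \<subseteq> verts H"
    and "\<exists>u\<in>verts G. \<exists>v\<in>verts G. f u \<noteq> f v"
  shows "sum_pairs (\<lambda>u v. (gdist H (f u) (f v))\<^sup>2 * real (out_degree G u) * real (out_degree G v))
           (verts G) \<ge> real (vol G) - 1"
proof -
  interpret G: graph G by fact
  interpret H: graph H by fact
  let ?V = "verts G"
  let ?d = "\<lambda>u. real (out_degree G u)"
  let ?g = "\<lambda>u v. (gdist H (f u) (f v))\<^sup>2 * ?d u * ?d v"
  have fH: "f u \<in> verts H" if "u \<in> ?V" for u
    using that assms(6) by auto
  obtain a b where ab: "a \<in> ?V" "b \<in> ?V" "f a \<noteq> f b"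
    using assms(7) by blast
  define S where "S = {v \<in> ?V. f v = f a}"
  have S: "S \<subseteq> ?V" "a \<in> S" "b \<in> ?V - S"
    using ab by (auto simp: S_def)
  \<comment> \<open>Since \<open>f a\<close> and \<open>f b\<close> differ, \<open>a\<close> and
    \<open>b\<close> are distinct vertices, each reachable from the other.\<close>
  have degs: "1 \<le> ?d a" "1 \<le> ?d b"
    using ab G.connected_imp_reachable[OF assms(2)] G.out_degree_pos[of a b] G.out_degree_pos[of b a]
    by fastforce+
  define s where "s = sum ?d S"
  define t where "t = sum ?d (?V - S)"
  have "finite S"
    using S(1) G.finite_verts by (rule finite_subset)
  have "?d a \<le> s" "?d b \<le> t"
    unfolding s_def t_def using S \<open>finite S\<close> by (auto intro!: member_le_sum)
  with degs have st: "1 \<le> s" "1 \<le> t" by auto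
  have "real (vol G) = s + t"
    unfolding vol_def s_def t_def using sum.subset_diff[OF S(1) G.finite_verts, of ?d] by simp
  \<comment> \<open>Expanded, this product says that \<open>s * t\<close> is at least
    \<open>s + t - 1\<close>.\<close>
  moreover have "0 \<le> (s - 1) * (t - 1)"
    using st by simp
  ultimately have "real (vol G) - 1 \<le> s * t"
    by (simp add: algebra_simps)
  also have "\<dots> = (\<Sum>u\<in>S. \<Sum>v\<in>?V - S. ?d u * ?d v)"
    by (simp add: s_def t_def sum_product)
  also have "\<dots> \<le> (\<Sum>u\<in>S. \<Sum>v\<in>?V - S. ?g u v)"
  proof (intro sum_mono)
    fix u v assume uv: "u \<in> S" "v \<in> ?V - S"
    \<comment> \<open>\<open>S\<close> is the whole fibre over \<open>f a\<close>, so a vertex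
      outside it has an image other than \<open>f a\<close>.\<close>
    then have "1 \<le> gdist H (f u) (f v)"
      by (intro H.gdist_ge_1 H.connected_imp_reachable assms(4) fH) (auto simp: S_def)
    then have "1 \<le> (gdist H (f u) (f v))\<^sup>2" by simp
    then have "1 * (?d u * ?d v) \<le> (gdist H (f u) (f v))\<^sup>2 * (?d u * ?d v)"
      by (intro mult_right_mono) auto
    then show "?d u * ?d v \<le> ?g u v" by (simp add: mult.assoc)
  qed
  \<comment> \<open>The weight inherits its symmetry and its zero diagonal from the distance in
    \<open>H\<close>.\<close>
  also have "\<dots> \<le> sum_pairs ?g ?V"
    using S(1) by (intro cut_sum_le_sum_pairs)
      (auto simp: H.gdist_refl fH H.gdist_sym[of "f _" "f _"] mult_ac intro: arg_cong)
  finally show ?thesis .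
qed

end
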